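(* Let $(X_t)_{t\ge 0}$ be a reversible Markov process on a probability space $(\Omega,\Sigma,\mathbb{P})$ with stationary measure $\mu$ and densely defined self-adjoint infinitesimal generator $\mathcal{L}:D(\mathcal{L})\to L^2(\Omega,\mu)$, where $L^2(\Omega,\mu)$ is a separable complex Hilbert space, and let $d\ge 1$ be an integer. Suppose $\mathcal{L}$ satisfies a Poincaré inequality with constant $\alpha>0$, i.e., $$\alpha\,\mathcal{E}(f,f):=\alpha\,\langle f,-\mathcal{L}f\rangle\ \ge\ \langle f,f\rangle$$ for all $f\in D(\mathcal{L})$ with $\mathbb{E}_\mu f=0$. Then $$\alpha\,\mathcal{E}_d(f,f):=\alpha\,\big\langle f,(-\mathcal{L}\otimes I_{\mathbb{C}^{d\times d}})f\big\rangle_d\ \succeq\ \langle f,f\rangle_d$$ for all $f\in D(\mathcal{L})\otimes\mathbb{C}^{d\times d}$ with $\mathbb{E}_\mu f=0$.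
   Context: The state space of the process is $(\Omega,\Sigma)$, and the stationary measure $\mu$ is a probability measure on it. $L^2(\Omega,\mu)$ is the space of complex-valued square-integrable functions with inner product $\langle f,g\rangle=\int_\Omega \overline{f(x)}\,g(x)\,d\mu(x)$ (conjugate-linear in the first argument). The infinitesimal generator $\mathcal{L}$ is the generator on $L^2(\Omega,\mu)$ of the Markov semigroup $P_tf(x)=\mathbb{E}[f(X_t)\mid X_0=x]$, i.e. $\mathcal{L}f=\lim_{t\downarrow 0}(P_tf-f)/t$ in $L^2(\Omega,\mu)$, with $D(\mathcal{L})$ the set of $f$ for which the limit exists; reversibility means that it is self-adjoint on $L^2(\Omega,\mu)$. $\mathbb{C}^{d\times d}$ is the Hilbert space of complex $d\times d$ matrices with the Hilbert–Schmidt inner product. The Hilbert space tensor product $L^2(\Omega,\mu)\otimes\mathbb{C}^{d\times d}$ is identified with $L^2(\Omega,\mu;\mathbb{C}^{d\times d})$, the square-integrable matrix-valued functions on $\Omega$. The "matrix-valued inner product" on it is $$\langle f,g\rangle_d:=\int_\Omega f(x)^*g(x)\,d\mu(x)\in\mathbb{C}^{d\times d},$$ where $^*$ is the conjugate transpose; the integral converges for all such $f,g$. Since $\mathbb{C}^{d\times d}$ is finite-dimensional, $D(\mathcal{L})\otimes\mathbb{C}^{d\times d}$ consists of the matrix-valued functions all of whose entries lie in $D(\mathcal{L})$, and $\mathcal{L}\otimes I_{\mathbb{C}^{d\times d}}$ acts on them by applying $\mathcal{L}$ to each entry. $\mathbb{E}_\mu f=\int_\Omega f\,d\mu$ (taken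 entrywise for matrix-valued $f$). $A\succeq B$ denotes the Löwner order on Hermitian matrices: $A-B$ is positive semidefinite. *)

theory Defs
  imports "HOL-Probability.Probability" "HOL-Library.Complex_Order"
begin

section \<open>Markov processes\<close>

text \<open>
  A time-homogeneous Markov process with state space \<open>S\<close> is given in the usual way by a
  measurable space \<open>W\<close> of scenarios, the variables \<open>X t\<close> for \<open>t \<ge> 0\<close> and, for every initial
  state \<open>x\<close>, the law \<open>P x\<close> on \<open>W\<close> of the process started in \<open>x\<close>, that is, the law
  conditioned on \<open>X 0 = x\<close>. Values of \<open>X\<close> at negative times are irrelevant.
\<close>

definition natural_filtration ::
  "'a measure \<Rightarrow> 'w measure \<Rightarrow> (real \<Rightarrow> 'w \<Rightarrow> 'a) \<Rightarrow> real \<Rightarrow> 'w measure"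
  where "natural_filtration S W X s =
    sigma (space W) {X u -` A \<inter> space W | u A. 0 \<le> u \<and> u \<le> s \<and> A \<in> sets S}"

locale markov_process =
  fixes S :: "'a measure" and W :: "'w measure"
    and P :: "'a \<Rightarrow> 'w measure" and X :: "real \<Rightarrow> 'w \<Rightarrow> 'a"
  assumes laws_measurable: "P \<in> S \<rightarrow>\<^sub>M prob_algebra W"
    and process_measurable: "0 \<le> t \<Longrightarrow> X t \<in> W \<rightarrow>\<^sub>M S"
    and initial_law: "x \<in> space S \<Longrightarrow> distr (P x) S (X 0) = return S x"
    and markov_property:
      "\<lbrakk>x \<in> space S; 0 \<le> s; 0 \<le> t; A \<in> sets S\<rbrakk> \<Longrightarrow>
        AE w in P x.
          real_cond_exp (P x) (natural_filtration S W X s)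
            (indicat_real (X (s + t) -` A \<inter> space W)) w
          = measure (P (X s w)) (X t -` A \<inter> space W)"

definition stationary_measure ::
  "'a measure \<Rightarrow> ('a \<Rightarrow> 'w measure) \<Rightarrow> (real \<Rightarrow> 'w \<Rightarrow> 'a) \<Rightarrow> 'a measure \<Rightarrow> bool"
  where "stationary_measure S P X \<mu> \<longleftrightarrow>
    prob_space \<mu> \<and> sets \<mu> = sets S \<and>
    (\<forall>t\<ge>0. \<mu> \<bind> (\<lambda>x. distr (P x) S (X t)) = \<mu>)"

definition markov_semigroup ::
  "('a \<Rightarrow> 'w measure) \<Rightarrow> (real \<Rightarrow> 'w \<Rightarrow> 'a) \<Rightarrow> real \<Rightarrow> ('a \<Rightarrow> complex) \<Rightarrow> 'a \<Rightarrow> complex"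
  where "markov_semigroup P X t f x = (\<integral>w. f (X t w) \<partial>P x)"


section \<open>The space of square-integrable functions\<close>

text \<open>
  Elements are represented by functions. Functions equal almost everywhere are not identified,
  so equality in the Hilbert space is \<open>AE x in \<mu>. f x = g x\<close>.
\<close>

definition L2 :: "'a measure \<Rightarrow> ('a \<Rightarrow> complex) set"
  where "L2 \<mu> = {f \<in> borel_measurable \<mu>. integrable \<mu> (\<lambda>x. (norm (f x))\<^sup>2)}"

definition L2_inner :: "'a measure \<Rightarrow> ('a \<Rightarrow> complex) \<Rightarrow> ('a \<Rightarrow> complex) \<Rightarrow> complex"
  where "L2_inner \<mu> f g = (\<integral>x. cnj (f x) * g x \<partial>\<mu>)"

definition L2_norm :: "'a measure \<Rightarrow> ('a \<Rightarrow> complex) \<Rightarrow> real"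
  where "L2_norm \<mu> f = sqrt (\<integral>x. (norm (f x))\<^sup>2 \<partial>\<mu>)"

definition L2_dense :: "'a measure \<Rightarrow> ('a \<Rightarrow> complex) set \<Rightarrow> bool"
  where "L2_dense \<mu> D \<longleftrightarrow>
    D \<subseteq> L2 \<mu> \<and> (\<forall>f\<in>L2 \<mu>. \<forall>\<epsilon>>0. \<exists>g\<in>D. L2_norm \<mu> (\<lambda>x. f x - g x) < \<epsilon>)"

definition L2_separable :: "'a measure \<Rightarrow> bool"
  where "L2_separable \<mu> \<longleftrightarrow> (\<exists>C. countable C \<and> L2_dense \<mu> C)"

text \<open>
  An operator is given by its domain \<open>D\<close> and its action \<open>T\<close>. The right-hand side says that it
  is densely defined and that the graph of its adjoint is its own graph.
\<close>

definition self_adjoint ::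
  "'a measure \<Rightarrow> ('a \<Rightarrow> complex) set \<Rightarrow> (('a \<Rightarrow> complex) \<Rightarrow> 'a \<Rightarrow> complex) \<Rightarrow> bool"
  where "self_adjoint \<mu> D T \<longleftrightarrow>
    L2_dense \<mu> D \<and> T ` D \<subseteq> L2 \<mu> \<and>
    (\<forall>g\<in>L2 \<mu>. \<forall>h\<in>L2 \<mu>.
      (\<forall>f\<in>D. L2_inner \<mu> g (T f) = L2_inner \<mu> h f) \<longleftrightarrow>
      (g \<in> D \<and> (AE x in \<mu>. h x = T g x)))"


section \<open>The infinitesimal generator\<close>

definition has_generator_value ::
  "('a \<Rightarrow> 'w measure) \<Rightarrow> (real \<Rightarrow> 'w \<Rightarrow> 'a) \<Rightarrow> 'a measure \<Rightarrow>
    ('a \<Rightarrow> complex) \<Rightarrow> ('a \<Rightarrow> complex) \<Rightarrow> bool"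
  where "has_generator_value P X \<mu> f g \<longleftrightarrow>
    f \<in> L2 \<mu> \<and> g \<in> L2 \<mu> \<and>
    ((\<lambda>t. L2_norm \<mu> (\<lambda>x. (markov_semigroup P X t f x - f x) / complex_of_real t - g x))
      \<longlongrightarrow> 0) (at_right 0)"

definition generator_domain ::
  "('a \<Rightarrow> 'w measure) \<Rightarrow> (real \<Rightarrow> 'w \<Rightarrow> 'a) \<Rightarrow> 'a measure \<Rightarrow> ('a \<Rightarrow> complex) set"
  where "generator_domain P X \<mu> = {f. \<exists>g. has_generator_value P X \<mu> f g}"

text \<open>The limit is unique up to almost everywhere equality; one representative is chosen.\<close>

definition generator ::
  "('a \<Rightarrow> 'w measure) \<Rightarrow> (real \<Rightarrow> 'w \<Rightarrow> 'a) \<Rightarrow> 'a measure \<Rightarrow> ('a \<Rightarrow> complex) \<Rightarrow> 'a \<Rightarrow> complex"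
  where "generator P X \<mu> f = (SOME g. has_generator_value P X \<mu> f g)"

definition dirichlet_form ::
  "'a measure \<Rightarrow> (('a \<Rightarrow> complex) \<Rightarrow> 'a \<Rightarrow> complex) \<Rightarrow> ('a \<Rightarrow> complex) \<Rightarrow> ('a \<Rightarrow> complex) \<Rightarrow> complex"
  where "dirichlet_form \<mu> T f g = L2_inner \<mu> f (\<lambda>x. - T g x)"


section \<open>Matrix-valued functions\<close>

definition conj_transpose :: "complex^'n^'m \<Rightarrow> complex^'m^'n"
  where "conj_transpose A = map_matrix cnj (transpose A)"

definition hermitian :: "complex^'n^'n \<Rightarrow> bool"
  where "hermitian A \<longleftrightarrow> conj_transpose A = A"

text \<open>
  The order on complex numbers from \<^theory>\<open>HOL-Library.Complex_Order\<close> compares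
  real parts and requires equal imaginary parts.
\<close>

definition pos_semidef :: "complex^'n^'n \<Rightarrow> bool"
  where "pos_semidef A \<longleftrightarrow>
    hermitian A \<and> (\<forall>v. (\<Sum>i\<in>UNIV. cnj (v $ i) * (A *v v) $ i) \<ge> 0)"

definition loewner_ge :: "complex^'n^'n \<Rightarrow> complex^'n^'n \<Rightarrow> bool"  (infix "\<succeq>" 50)
  where "A \<succeq> B \<longleftrightarrow> hermitian A \<and> hermitian B \<and> pos_semidef (A - B)"

definition matrix_inner ::
  "'a measure \<Rightarrow> ('a \<Rightarrow> complex^'d^'d) \<Rightarrow> ('a \<Rightarrow> complex^'d^'d) \<Rightarrow> complex^'d^'d"
  where "matrix_inner \<mu> f g = (\<integral>x. conj_transpose (f x) ** g x \<partial>\<mu>)"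

text \<open>
  For an operator with domain \<open>D\<close> and action \<open>T\<close>, the next two definitions give the domain
  and the action of its tensor product with the identity on matrices, under the identification
  of the tensor product space with the square-integrable matrix-valued functions.
\<close>

definition tensor_domain :: "('a \<Rightarrow> complex) set \<Rightarrow> ('a \<Rightarrow> complex^'d^'d) set"
  where "tensor_domain D = {f. \<forall>i j. (\<lambda>x. f x $ i $ j) \<in> D}"

definition tensor_id ::
  "(('a \<Rightarrow> complex) \<Rightarrow> 'a \<Rightarrow> complex) \<Rightarrow> ('a \<Rightarrow> complex^'d^'d) \<Rightarrow> 'a \<Rightarrow> complex^'d^'d"
  where "tensor_id T f = (\<lambda>x. \<chi> i j. T (\<lambda>y. f y $ i $ j) x)"

definition matrix_dirichlet_form ::
  "'a measure \<Rightarrow> (('a \<Rightarrow> complex) \<Rightarrow> 'a \<Rightarrow> complex) \<Rightarrow>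
    ('a \<Rightarrow> complex^'d^'d) \<Rightarrow> ('a \<Rightarrow> complex^'d^'d) \<Rightarrow> complex^'d^'d"
  where "matrix_dirichlet_form \<mu> T f g =
    matrix_inner \<mu> f (tensor_id (\<lambda>u x. - T u x) g)"

end

theory Submission
  imports Defs
begin

text \<open>
  For a vector \<open>v\<close>, the quadratic form of \<open>\<langle>f, g\<rangle>\<^sub>d\<close> at \<open>v\<close> is the sum over \<open>k\<close> of the scalar
  inner products \<open>\<langle>(f v)\<^sub>k, (g v)\<^sub>k\<rangle>\<close> of the components of the vector-valued functions \<open>f v\<close> and
  \<open>g v\<close> (lemma \<open>matrix_inner_quadratic_form\<close>). If all entries of \<open>f\<close> lie in the domain of the
  operator and have mean zero, then so do the components \<open>(f v)\<^sub>k\<close>, being linear combinations of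
  entries. By linearity the operator maps \<open>(f v)\<^sub>k\<close> to the \<open>k\<close>-th component of \<open>g v\<close>, where \<open>g\<close>
  is its entrywise action on \<open>f\<close>. Hence the scalar inequality, applied to each \<open>(f v)\<^sub>k\<close> and summed
  over \<open>k\<close>, is the matrix inequality tested on \<open>v\<close> (lemma \<open>matrix_poincare\<close>). Both sides are
  Hermitian because the inner product is conjugate symmetric and the operator is symmetric.

  Linearity comes from self-adjointness: the graph of an adjoint is cut out by linear conditions,
  so it is a linear subspace, and a self-adjoint operator has the same graph as its adjoint
  (lemma \<open>self_adjoint_linear_combination\<close>).
\<close>

section \<open>Square-integrable functions\<close>

lemma L2_mult_integrable:
  assumes "f \<in> L2 \<mu>" "g \<in> L2 \<mu>"
  shows "integrable \<mu> (\<lambda>x. cnj (f x) * g x)"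
proof (rule Bochner_Integration.integrable_bound)
  show "integrable \<mu> (\<lambda>x. (norm (f x))\<^sup>2 + (norm (g x))\<^sup>2)"
    using assms by (simp add: L2_def)
  have "cnj \<in> borel_measurable borel"
    by (intro borel_measurable_continuous_onI continuous_intros)
  then show "(\<lambda>x. cnj (f x) * g x) \<in> borel_measurable \<mu>"
    using assms by (auto simp: L2_def intro: measurable_compose)
  have "a * b \<le> a\<^sup>2 + b\<^sup>2" if "a \<ge> 0" "b \<ge> 0" for a b :: real
    using sum_squares_bound[of a b] mult_nonneg_nonneg[OF that] by linarith
  then show "AE x in \<mu>. norm (cnj (f x) * g x) \<le> norm ((norm (f x))\<^sup>2 + (norm (g x))\<^sup>2)"
    by (simp add: norm_mult)
qed

lemma L2_cmult:
  assumes "f \<in> L2 \<mu>"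
  shows "(\<lambda>x. c * f x) \<in> L2 \<mu>"
  using assms by (auto simp: L2_def norm_mult power_mult_distrib)

lemma L2_uminus: "f \<in> L2 \<mu> \<Longrightarrow> (\<lambda>x. - f x) \<in> L2 \<mu>"
  using L2_cmult[of f \<mu> "-1"] by simp

lemma L2_add:
  assumes "f \<in> L2 \<mu>" "g \<in> L2 \<mu>"
  shows "(\<lambda>x. f x + g x) \<in> L2 \<mu>"
proof -
  have "integrable \<mu> (\<lambda>x. (norm (f x + g x))\<^sup>2)"
  proof (rule Bochner_Integration.integrable_bound)
    show "integrable \<mu> (\<lambda>x. 2 * (norm (f x))\<^sup>2 + 2 * (norm (g x))\<^sup>2)"
      using assms by (simp add: L2_def)
    show "(\<lambda>x. (norm (f x + g x))\<^sup>2) \<in> borel_measurable \<mu>"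
      using assms by (auto simp: L2_def)
    have "(norm (a + b))\<^sup>2 \<le> 2 * (norm a)\<^sup>2 + 2 * (norm b)\<^sup>2" for a b :: complex
    proof -
      have "(norm (a + b))\<^sup>2 \<le> (norm a + norm b)\<^sup>2"
        by (intro power_mono norm_triangle_ineq) simp
      also have "\<dots> \<le> 2 * (norm a)\<^sup>2 + 2 * (norm b)\<^sup>2"
        using sum_squares_bound[of "norm a" "norm b"] by (simp add: power2_sum)
      finally show ?thesis .
    qed
    then show "AE x in \<mu>. norm ((norm (f x + g x))\<^sup>2)
        \<le> norm (2 * (norm (f x))\<^sup>2 + 2 * (norm (g x))\<^sup>2)"
      by simp
  qed
  then show ?thesis
    using assms by (auto simp: L2_def)
qed

lemma L2_linear_combination:
  assumes "finite J" "\<And>j. j \<in> J \<Longrightarrow> u j \<in> L2 \<mu>"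
  shows "(\<lambda>x. \<Sum>j\<in>J. c j * u j x) \<in> L2 \<mu>"
  using assms
proof (induction J rule: finite_induct)
  case empty
  then show ?case by (simp add: L2_def)
next
  case (insert j J)
  then show ?case by (auto intro!: L2_add L2_cmult)
qed

lemma (in finite_measure) L2_integrable:
  assumes "f \<in> L2 M"
  shows "integrable M f"
proof -
  have "(\<lambda>x. 1) \<in> L2 M"
    by (simp add: L2_def)
  from L2_mult_integrable[OF this assms] show ?thesis by simp
qed

lemma L2_inner_cnj: "L2_inner \<mu> g f = cnj (L2_inner \<mu> f g)"
  unfolding L2_inner_def by (simp add: mult.commute flip: Bochner_Integration.integral_cnj)

lemma L2_inner_cong_AE_right:
  assumes "AE x in \<mu>. g x = h x" "f \<in> L2 \<mu>" "g \<in> L2 \<mu>" "h \<in> L2 \<mu>"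
  shows "L2_inner \<mu> f g = L2_inner \<mu> f h"
  unfolding L2_inner_def
  using assms(1)
  by (intro integral_cong_AE borel_measurable_integrable L2_mult_integrable assms(2-)) auto

lemma L2_inner_sum_right:
  assumes "finite J" "f \<in> L2 \<mu>" "\<And>j. j \<in> J \<Longrightarrow> u j \<in> L2 \<mu>"
  shows "L2_inner \<mu> f (\<lambda>x. \<Sum>j\<in>J. c j * u j x) = (\<Sum>j\<in>J. c j * L2_inner \<mu> f (u j))"
proof -
  have "L2_inner \<mu> f (\<lambda>x. \<Sum>j\<in>J. c j * u j x) = (\<integral>x. (\<Sum>j\<in>J. c j * (cnj (f x) * u j x)) \<partial>\<mu>)"
    unfolding L2_inner_def by (simp add: sum_distrib_left ac_simps)
  also have "\<dots> = (\<Sum>j\<in>J. c j * L2_inner \<mu> f (u j))"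
    unfolding L2_inner_def using assms
    by (subst Bochner_Integration.integral_sum) (auto intro!: L2_mult_integrable)
  finally show ?thesis .
qed

lemma L2_inner_sum_left:
  assumes "finite J" "f \<in> L2 \<mu>" "\<And>j. j \<in> J \<Longrightarrow> u j \<in> L2 \<mu>"
  shows "L2_inner \<mu> (\<lambda>x. \<Sum>j\<in>J. c j * u j x) f = (\<Sum>j\<in>J. cnj (c j) * L2_inner \<mu> (u j) f)"
proof -
  have "L2_inner \<mu> (\<lambda>x. \<Sum>j\<in>J. c j * u j x) f
      = cnj (\<Sum>j\<in>J. c j * L2_inner \<mu> f (u j))"
    using L2_inner_sum_right[OF assms, where c = c] by (simp add: L2_inner_cnj[of \<mu> _ f])
  also have "\<dots> = (\<Sum>j\<in>J. cnj (c j) * L2_inner \<mu> (u j) f)"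
    by (simp add: L2_inner_cnj[of \<mu> _ f])
  finally show ?thesis .
qed

section \<open>Self-adjoint operators\<close>

lemma self_adjoint_domain_L2: "self_adjoint \<mu> D T \<Longrightarrow> f \<in> D \<Longrightarrow> f \<in> L2 \<mu>"
  unfolding self_adjoint_def L2_dense_def by blast

lemma self_adjoint_range_L2: "self_adjoint \<mu> D T \<Longrightarrow> f \<in> D \<Longrightarrow> T f \<in> L2 \<mu>"
  unfolding self_adjoint_def by blast

lemma self_adjoint_symmetric:
  assumes sa: "self_adjoint \<mu> D T" and "f \<in> D" "g \<in> D"
  shows "L2_inner \<mu> g (T f) = L2_inner \<mu> (T g) f"
  using assms self_adjoint_domain_L2[OF sa \<open>g \<in> D\<close>] self_adjoint_range_L2[OF sa \<open>g \<in> D\<close>]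
  unfolding self_adjoint_def by blast

text \<open>
  The conditions \<open>\<langle>g, T f\<rangle> = \<langle>h, f\<rangle>\<close> for \<open>f \<in> D\<close>, which say that \<open>(g, h)\<close> is in the graph of the
  adjoint, are preserved by taking linear combinations of such pairs. As this graph is the graph of
  \<open>T\<close> itself, the combination of the pairs \<open>(u j, T (u j))\<close> lies in it, which is linearity of \<open>T\<close>.
\<close>

lemma self_adjoint_linear_combination:
  assumes sa: "self_adjoint \<mu> D T" and J: "finite J" and u: "\<And>j. j \<in> J \<Longrightarrow> u j \<in> D"
  shows "(\<lambda>x. \<Sum>j\<in>J. c j * u j x) \<in> D"
    and "AE x in \<mu>. T (\<lambda>x. \<Sum>j\<in>J. c j * u j x) x = (\<Sum>j\<in>J. c j * T (u j) x)"
proof -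
  let ?g = "\<lambda>x. \<Sum>j\<in>J. c j * u j x" and ?h = "\<lambda>x. \<Sum>j\<in>J. c j * T (u j) x"
  note dom = self_adjoint_domain_L2[OF sa] and ran = self_adjoint_range_L2[OF sa]
  have L2: "?g \<in> L2 \<mu>" "?h \<in> L2 \<mu>"
    by (auto intro!: L2_linear_combination J intro: dom ran u)
  have "L2_inner \<mu> ?g (T f) = L2_inner \<mu> ?h f" if f: "f \<in> D" for f
  proof -
    have "L2_inner \<mu> ?g (T f) = (\<Sum>j\<in>J. cnj (c j) * L2_inner \<mu> (u j) (T f))"
      using J u f by (intro L2_inner_sum_left dom ran)
    also have "\<dots> = (\<Sum>j\<in>J. cnj (c j) * L2_inner \<mu> (T (u j)) f)"
      using u f by (simp add: self_adjoint_symmetric[OF sa])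
    also have "\<dots> = L2_inner \<mu> ?h f"
      using J u f by (intro L2_inner_sum_left[symmetric] dom ran)
    finally show ?thesis .
  qed
  moreover have "(\<forall>f\<in>D. L2_inner \<mu> ?g (T f) = L2_inner \<mu> ?h f)
      \<longleftrightarrow> ?g \<in> D \<and> (AE x in \<mu>. ?h x = T ?g x)"
    using sa[unfolded self_adjoint_def, THEN conjunct2, THEN conjunct2, rule_format, OF L2] .
  ultimately have "?g \<in> D \<and> (AE x in \<mu>. ?h x = T ?g x)"
    by simp
  then show "?g \<in> D" and "AE x in \<mu>. T ?g x = ?h x"
    by (auto simp: eq_commute)
qed

section \<open>The matrix-valued inner product\<close>

lemma integrable_vec:
  fixes f :: "'a \<Rightarrow> 'b::euclidean_space^'n"
  assumes "\<And>i. integrable M (\<lambda>x. f x $ i)"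
  shows "integrable M f"
proof -
  have "bounded_linear (axis i :: 'b \<Rightarrow> 'b^'n)" for i
    by (auto intro!: linearI simp: linear_conv_bounded_linear[symmetric] vec_eq_iff axis_def)
  from integrable_bounded_linear[OF this assms]
  have "integrable M (\<lambda>x. \<Sum>i\<in>UNIV. axis i (f x $ i))"
    by (rule Bochner_Integration.integrable_sum)
  moreover have "(\<Sum>i\<in>UNIV. axis i (y $ i)) = y" for y :: "'b^'n"
    by (simp add: vec_eq_iff axis_def if_distrib cong: if_cong)
  ultimately show ?thesis by simp
qed

lemma integral_matrix_entry:
  fixes f :: "'a \<Rightarrow> 'b::euclidean_space^'n^'m"
  assumes "\<And>i j. integrable M (\<lambda>x. f x $ i $ j)"
  shows "(\<integral>x. f x \<partial>M) $ i $ j = (\<integral>x. f x $ i $ j \<partial>M)"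
proof -
  have rows: "integrable M (\<lambda>x. f x $ k)" for k
    by (rule integrable_vec) (rule assms)
  then have "integrable M f"
    by (rule integrable_vec)
  then show ?thesis
    using integral_bounded_linear[OF bounded_linear_vec_nth, of M f i]
      integral_bounded_linear[OF bounded_linear_vec_nth rows[of i], of j]
    by simp
qed

text \<open>
  Square-integrability of the entries makes the integrand integrable, so that the integral may be
  computed entrywise; a matrix with a single non-integrable entry has Bochner integral zero.
\<close>

lemma matrix_inner_entry:
  fixes f g :: "'a \<Rightarrow> complex^'d^'d"
  assumes f: "\<And>i j. (\<lambda>x. f x $ i $ j) \<in> L2 \<mu>" and g: "\<And>i j. (\<lambda>x. g x $ i $ j) \<in> L2 \<mu>"
  shows "matrix_inner \<mu> f g $ i $ j
    = (\<Sum>k\<in>UNIV. L2_inner \<mu> (\<lambda>x. f x $ k $ i) (\<lambda>x. g x $ k $ j))"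
proof -
  have entry: "(conj_transpose (f x) ** g x) $ i $ j = (\<Sum>k\<in>UNIV. cnj (f x $ k $ i) * g x $ k $ j)"
    for x i j
    by (simp add: conj_transpose_def matrix_matrix_mult_def map_matrix_def transpose_def)
  have "matrix_inner \<mu> f g $ i $ j = (\<integral>x. (conj_transpose (f x) ** g x) $ i $ j \<partial>\<mu>)"
    unfolding matrix_inner_def
    by (rule integral_matrix_entry) (auto simp: entry intro!: L2_mult_integrable f g)
  also have "\<dots> = (\<Sum>k\<in>UNIV. L2_inner \<mu> (\<lambda>x. f x $ k $ i) (\<lambda>x. g x $ k $ j))"
    unfolding entry L2_inner_def
    by (rule Bochner_Integration.integral_sum) (auto intro!: L2_mult_integrable f g)
  finally show ?thesis .
qed

lemma hermitian_iff: "hermitian A \<longleftrightarrow> (\<forall>i j. cnj (A $ j $ i) = A $ i $ j)"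
  by (auto simp: hermitian_def conj_transpose_def map_matrix_def transpose_def vec_eq_iff)

lemma hermitian_scaleR: "hermitian A \<Longrightarrow> hermitian (r *\<^sub>R A)"
  by (simp add: hermitian_iff)

lemma hermitian_diff: "hermitian A \<Longrightarrow> hermitian B \<Longrightarrow> hermitian (A - B)"
  by (simp add: hermitian_iff)

text \<open>
  The symmetry condition holds trivially for \<open>g = f\<close>, and for the entrywise action \<open>g\<close> of a
  symmetric operator on \<open>f\<close>; these are the two sides of the matrix inequality.
\<close>

lemma matrix_inner_hermitian:
  fixes f g :: "'a \<Rightarrow> complex^'d^'d"
  assumes "\<And>i j. (\<lambda>x. f x $ i $ j) \<in> L2 \<mu>" "\<And>i j. (\<lambda>x. g x $ i $ j) \<in> L2 \<mu>"
    and sym: "\<And>i j k. L2_inner \<mu> (\<lambda>x. f x $ k $ i) (\<lambda>x. g x $ k $ j)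
      = L2_inner \<mu> (\<lambda>x. g x $ k $ i) (\<lambda>x. f x $ k $ j)"
  shows "hermitian (matrix_inner \<mu> f g)"
proof -
  have "cnj (L2_inner \<mu> (\<lambda>x. f x $ k $ j) (\<lambda>x. g x $ k $ i))
      = L2_inner \<mu> (\<lambda>x. f x $ k $ i) (\<lambda>x. g x $ k $ j)" for i j k
    by (simp only: sym[of k i j] flip: L2_inner_cnj)
  then show ?thesis
    by (simp add: hermitian_iff matrix_inner_entry assms(1,2))
qed

text \<open>
  Summing entry \<open>(i, j)\<close>, itself a sum over the row index \<open>k\<close>, against \<open>v\<close> and exchanging the sums
  puts \<open>k\<close> outermost; the sums over \<open>i\<close> and \<open>j\<close> then move into the two arguments of the inner
  product by sesquilinearity.
\<close>

lemma matrix_inner_quadratic_form: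
  fixes f g :: "'a \<Rightarrow> complex^'d^'d" and v :: "complex^'d"
  assumes f: "\<And>i j. (\<lambda>x. f x $ i $ j) \<in> L2 \<mu>" and g: "\<And>i j. (\<lambda>x. g x $ i $ j) \<in> L2 \<mu>"
  shows "(\<Sum>i\<in>UNIV. cnj (v $ i) * (matrix_inner \<mu> f g *v v) $ i)
    = (\<Sum>k\<in>UNIV. L2_inner \<mu> (\<lambda>x. \<Sum>j\<in>UNIV. v $ j * f x $ k $ j)
        (\<lambda>x. \<Sum>j\<in>UNIV. v $ j * g x $ k $ j))"
proof -
  let ?I = "\<lambda>k i j. L2_inner \<mu> (\<lambda>x. f x $ k $ i) (\<lambda>x. g x $ k $ j)"
  have "(\<Sum>i\<in>UNIV. cnj (v $ i) * (matrix_inner \<mu> f g *v v) $ i)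
      = (\<Sum>i\<in>UNIV. \<Sum>j\<in>UNIV. \<Sum>k\<in>UNIV. cnj (v $ i) * (v $ j * ?I k i j))"
    by (simp add: matrix_vector_mult_def matrix_inner_entry[OF f g] sum_distrib_left
        sum_distrib_right ac_simps)
  also have "\<dots> = (\<Sum>i\<in>UNIV. \<Sum>k\<in>UNIV. \<Sum>j\<in>UNIV. cnj (v $ i) * (v $ j * ?I k i j))"
    by (intro sum.cong refl sum.swap)
  also have "\<dots> = (\<Sum>k\<in>UNIV. \<Sum>i\<in>UNIV. \<Sum>j\<in>UNIV. cnj (v $ i) * (v $ j * ?I k i j))"
    by (rule sum.swap)
  also have "\<dots> = (\<Sum>k\<in>UNIV. \<Sum>i\<in>UNIV. cnj (v $ i) *
      L2_inner \<mu> (\<lambda>x. f x $ k $ i) (\<lambda>x. \<Sum>j\<in>UNIV. v $ j * g x $ k $ j))"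
    by (simp add: L2_inner_sum_right f g sum_distrib_left)
  also have "\<dots> = (\<Sum>k\<in>UNIV. L2_inner \<mu> (\<lambda>x. \<Sum>j\<in>UNIV. v $ j * f x $ k $ j)
      (\<lambda>x. \<Sum>j\<in>UNIV. v $ j * g x $ k $ j))"
    by (intro sum.cong refl L2_inner_sum_left[symmetric] L2_linear_combination f g) simp_all
  finally show ?thesis .
qed

section \<open>The Poincare inequality for matrix-valued functions\<close>

text \<open>
  Finiteness of the measure makes square-integrable functions integrable, so that the vanishing
  Bochner integral of \<open>f\<close> gives each entry mean zero; the integral of a non-integrable function
  would vanish by convention and say nothing about the entries.
\<close>

lemma matrix_poincare:
  fixes f :: "'a \<Rightarrow> complex^'d^'d" and \<alpha> :: real
  assumes fin: "finite_measure \<mu>" and sa: "self_adjoint \<mu> D T"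
    and poincare: "\<And>u. u \<in> D \<Longrightarrow> (\<integral>x. u x \<partial>\<mu>) = 0 \<Longrightarrow>
      L2_inner \<mu> u u \<le> complex_of_real \<alpha> * dirichlet_form \<mu> T u u"
    and f: "f \<in> tensor_domain D" and mean: "(\<integral>x. f x \<partial>\<mu>) = 0"
  shows "\<alpha> *\<^sub>R matrix_dirichlet_form \<mu> T f f \<succeq> matrix_inner \<mu> f f"
proof -
  note dom = self_adjoint_domain_L2[OF sa] and ran = self_adjoint_range_L2[OF sa]
  have fD: "(\<lambda>x. f x $ i $ j) \<in> D" for i j
    using f by (simp add: tensor_domain_def)
  define g where "g = tensor_id (\<lambda>u x. - T u x) f"
  have g_entry: "g x $ i $ j = - T (\<lambda>y. f y $ i $ j) x" for x i j
    by (simp add: g_def tensor_id_def)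
  have fL2: "(\<lambda>x. f x $ i $ j) \<in> L2 \<mu>" for i j
    using fD by (rule dom)
  have gL2: "(\<lambda>x. g x $ i $ j) \<in> L2 \<mu>" for i j
    unfolding g_entry by (intro L2_uminus ran fD)
  have f_int: "integrable \<mu> (\<lambda>x. f x $ i $ j)" for i j
    using fin fL2 by (rule finite_measure.L2_integrable)
  have f_mean: "(\<integral>x. f x $ i $ j \<partial>\<mu>) = 0" for i j
    using integral_matrix_entry[of \<mu> f i j] f_int mean by simp

  define A where "A = matrix_inner \<mu> f g"
  define B where "B = matrix_inner \<mu> f f"
  have "L2_inner \<mu> (\<lambda>x. f x $ k $ i) (\<lambda>x. g x $ k $ j)
      = L2_inner \<mu> (\<lambda>x. g x $ k $ i) (\<lambda>x. f x $ k $ j)" for i j k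
    using self_adjoint_symmetric[OF sa fD[of k j] fD[of k i]]
    by (simp add: L2_inner_def g_entry)
  then have A: "hermitian A"
    unfolding A_def by (intro matrix_inner_hermitian fL2 gL2)
  have B: "hermitian B"
    unfolding B_def by (intro matrix_inner_hermitian fL2 refl)

  have "0 \<le> (\<Sum>i\<in>UNIV. cnj (v $ i) * ((\<alpha> *\<^sub>R A - B) *v v) $ i)" for v :: "complex^'d"
  proof -
    define u where "u k = (\<lambda>x. \<Sum>j\<in>UNIV. v $ j * f x $ k $ j)" for k
    have uD: "u k \<in> D" for k
      unfolding u_def by (intro self_adjoint_linear_combination(1)[OF sa] fD) simp
    have Tu: "AE x in \<mu>. T (u k) x = (\<Sum>j\<in>UNIV. v $ j * T (\<lambda>x. f x $ k $ j) x)" for k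
      unfolding u_def by (intro self_adjoint_linear_combination(2)[OF sa] fD) simp
    have "(\<integral>x. u k x \<partial>\<mu>) = 0" for k
      unfolding u_def by (simp add: Bochner_Integration.integral_sum f_int f_mean)
    then have le: "L2_inner \<mu> (u k) (u k) \<le> complex_of_real \<alpha> * dirichlet_form \<mu> T (u k) (u k)"
      for k
      by (rule poincare[OF uD])
    \<comment> \<open>Linearity identifies \<open>- T (u k)\<close> with the combination of the entries of \<open>g\<close> only almost
      everywhere, which suffices under the integral.\<close>
    have "dirichlet_form \<mu> T (u k) (u k)
        = L2_inner \<mu> (u k) (\<lambda>x. \<Sum>j\<in>UNIV. v $ j * g x $ k $ j)" for k
      unfolding dirichlet_form_def
    proof (rule L2_inner_cong_AE_right)
      show "AE x in \<mu>. - T (u k) x = (\<Sum>j\<in>UNIV. v $ j * g x $ k $ j)"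
        using Tu[of k] by eventually_elim (simp add: g_entry sum_negf)
    qed (intro L2_linear_combination gL2 L2_uminus dom ran uD finite)+
    then have qA: "(\<Sum>i\<in>UNIV. cnj (v $ i) * (A *v v) $ i)
        = (\<Sum>k\<in>UNIV. dirichlet_form \<mu> T (u k) (u k))"
      unfolding A_def by (simp add: matrix_inner_quadratic_form[OF fL2 gL2] flip: u_def)
    have qB: "(\<Sum>i\<in>UNIV. cnj (v $ i) * (B *v v) $ i) = (\<Sum>k\<in>UNIV. L2_inner \<mu> (u k) (u k))"
      unfolding B_def by (simp add: matrix_inner_quadratic_form[OF fL2 fL2] flip: u_def)
    have "(\<Sum>i\<in>UNIV. cnj (v $ i) * ((\<alpha> *\<^sub>R A - B) *v v) $ i)
        = complex_of_real \<alpha> * (\<Sum>i\<in>UNIV. cnj (v $ i) * (A *v v) $ i)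
          - (\<Sum>i\<in>UNIV. cnj (v $ i) * (B *v v) $ i)"
      by (simp add: matrix_vector_mult_def scaleR_conv_of_real[where 'a = complex] sum_distrib_left sum_subtractf
          algebra_simps)
    also have "\<dots> = (\<Sum>k\<in>UNIV. complex_of_real \<alpha> * dirichlet_form \<mu> T (u k) (u k)
        - L2_inner \<mu> (u k) (u k))"
      unfolding qA qB by (simp add: sum_distrib_left sum_subtractf)
    also have "\<dots> \<ge> 0"
      using le by (intro sum_nonneg) simp
    finally show ?thesis .
  qed
  with A B have "\<alpha> *\<^sub>R A \<succeq> B"
    by (simp add: loewner_ge_def pos_semidef_def hermitian_scaleR hermitian_diff)
  then show ?thesis
    by (simp add: A_def B_def g_def matrix_dirichlet_form_def)
qed

theorem theorem1p1:
  fixes S \<mu> :: "'a measure" and W :: "'w measure"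
    and P :: "'a \<Rightarrow> 'w measure" and X :: "real \<Rightarrow> 'w \<Rightarrow> 'a"
    and \<alpha> :: real
  assumes "markov_process S W P X"
    and "stationary_measure S P X \<mu>"
    and "L2_separable \<mu>"
    and "self_adjoint \<mu> (generator_domain P X \<mu>) (generator P X \<mu>)"
    and "\<alpha> > 0"
    and "\<forall>f\<in>generator_domain P X \<mu>. (\<integral>x. f x \<partial>\<mu>) = 0 \<longrightarrow>
      complex_of_real \<alpha> * dirichlet_form \<mu> (generator P X \<mu>) f f \<ge> L2_inner \<mu> f f"
  shows "\<forall>f :: 'a \<Rightarrow> complex^'d^'d.
    f \<in> tensor_domain (generator_domain P X \<mu>) \<longrightarrow> (\<integral>x. f x \<partial>\<mu>) = 0 \<longrightarrow>
      \<alpha> *\<^sub>R matrix_dirichlet_form \<mu> (generator P X \<mu>) f f \<succeq> matrix_inner \<mu> f f"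
proof -
  have "finite_measure \<mu>"
    using assms(2) by (simp add: stationary_measure_def prob_space_def)
  from matrix_poincare[OF this assms(4)] assms(6) show ?thesis
    by blast
qed

end
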